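(* Let $\mathcal{A}(1)=\{(1,0),(1,1),(1,2)\}\subset\mathbb{Z}^2$, $w=(1,1,1)$, and $\mathcal{A}(1)_w=\{(1,0,1),(1,1,1),(1,2,1),(0,0,1)\}\subset\mathbb{Z}^3$. Then the semigroup $\mathbb{N}\mathcal{A}(1)_w$ is saturated.
   Context: $\mathbb{N}$ contains $0$. For a finite set $\mathcal{B}\subset\mathbb{Z}^k$, $\mathbb{N}\mathcal{B}$ is the submonoid of $\mathbb{Z}^k$ generated by $\mathcal{B}$. The semigroup $S=\mathbb{N}\mathcal{B}$ is saturated if $S=\overline{S}$, where $\overline{S}:=\mathbb{R}_{\geq0}S\cap\mathbb{Z}^k$ and $\mathbb{R}_{\geq 0}S$ is the cone of nonnegative real linear combinations of elements of $S$. *)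

theory Defs
  imports "HOL-Analysis.Analysis"
begin

definition submonoid :: "'a::monoid_add set \<Rightarrow> bool" where
  "submonoid M \<longleftrightarrow> 0 \<in> M \<and> (\<forall>x\<in>M. \<forall>y\<in>M. x + y \<in> M)"

definition nat_span :: "(int ^ 'k) set \<Rightarrow> (int ^ 'k) set" where
  "nat_span B = submonoid hull B"

definition real_vec :: "int ^ 'k \<Rightarrow> real ^ 'k" where
  "real_vec v = (\<chi> i. real_of_int (v $ i))"

definition nonneg_cone :: "'a::real_vector set \<Rightarrow> 'a set" where
  "nonneg_cone X = {\<Sum>x\<in>T. c x *\<^sub>R x | T c. finite T \<and> T \<subseteq> X \<and> (\<forall>x\<in>T. 0 \<le> c x)}"

definition saturation :: "(int ^ 'k) set \<Rightarrow> (int ^ 'k) set" where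
  "saturation S = {v. real_vec v \<in> nonneg_cone (real_vec ` S)}"

definition saturated :: "(int ^ 'k) set \<Rightarrow> bool" where
  "saturated S \<longleftrightarrow> S = saturation S"

text \<open>The configuration is listed in the order in which the weights are attached to its elements.\<close>

definition A1 :: "(int ^ 2) list" where
  "A1 = [vector [1, 0], vector [1, 1], vector [1, 2]]"

definition w :: "int list" where
  "w = [1, 1, 1]"

definition A1w :: "(int ^ 3) set" where
  "A1w = {vector [1, 0, 1], vector [1, 1, 1], vector [1, 2, 1], vector [0, 0, 1]}"

text \<open>Each element of the configuration is extended by its weight, and \<open>(0, 0, 1)\<close> is adjoined.\<close>

lemma A1w_eq:
  "A1w = {vector [a $ 1, a $ 2, c] | a c. (a, c) \<in> set (zip A1 w)} \<union> {vector [0, 0, 1]}"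
proof -
  have "{vector [a $ 1, a $ 2, c] | a c. (a, c) \<in> set (zip A1 w)}
      = (\<lambda>(a, c). vector [a $ 1, a $ 2, c] :: int ^ 3) ` set (zip A1 w)"
    by force
  also have "\<dots> = {vector [1, 0, 1], vector [1, 1, 1], vector [1, 2, 1]}"
    by (simp add: A1_def w_def vector_2)
  finally show ?thesis
    by (auto simp: A1w_def)
qed

end

theory Submission
  imports Defs
begin

text \<open>The cone spanned by the configuration is cut out by the inequalities \<open>0 \<le> y\<close>, \<open>y \<le> 2 x\<close> and
  \<open>x \<le> z\<close>. It is divided by the plane \<open>x = y\<close> into two unimodular cones, in each of which an
  integer point is an explicit natural combination of three of the four generators.\<close>

lemma subset_nat_span: "B \<subseteq> nat_span B"
  unfolding nat_span_def by (rule hull_subset)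

text \<open>Any intersection of submonoids is again a submonoid, which is what
  \<open>hull_in\<close> asks for.\<close>

lemma submonoid_nat_span: "submonoid (nat_span B)"
  unfolding nat_span_def by (rule hull_in) (auto simp: submonoid_def)

lemma nat_span_minimal:
  assumes "B \<subseteq> M" and "submonoid M"
  shows "nat_span B \<subseteq> M"
  unfolding nat_span_def using assms by (rule hull_minimal)

lemma nat_span_add: "u \<in> nat_span B \<Longrightarrow> v \<in> nat_span B \<Longrightarrow> u + v \<in> nat_span B"
  using submonoid_nat_span[of B] by (simp add: submonoid_def)

text \<open>Stated for integer \<open>m\<close> because the coefficients used later are differences
  of integer coordinates; repeated addition settles the natural multiples.\<close>

lemma nat_span_scale:
  assumes v: "v \<in> nat_span B" and "0 \<le> m"
  shows "m *s v \<in> nat_span B"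
proof -
  have "int n *s v \<in> nat_span B" for n
  proof (induction n)
    case 0
    then show ?case
      using submonoid_nat_span[of B] by (simp add: submonoid_def)
  next
    case (Suc n)
    have "int (Suc n) *s v = v + int n *s v"
      by (simp add: vec_eq_iff algebra_simps)
    then show ?case
      using nat_span_add[OF v Suc.IH] by simp
  qed
  from this[of "nat m"] show ?thesis
    using \<open>0 \<le> m\<close> by simp
qed

lemma subset_saturation: "S \<subseteq> saturation S"
proof
  fix v assume "v \<in> S"
  then have "finite {real_vec v} \<and> {real_vec v} \<subseteq> real_vec ` S"
    by simp
  moreover have "real_vec v = (\<Sum>x\<in>{real_vec v}. 1 *\<^sub>R x)"
    by simp
  ultimately show "v \<in> saturation S"
    unfolding saturation_def nonneg_cone_def mem_Collect_eq
    by (intro exI[of _ "{real_vec v}"] exI[of _ "\<lambda>_. 1"]) auto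
qed

text \<open>Linearity turns \<open>f u\<close> into a sum of products of nonnegative numbers. This
  carries linear inequalities from a semigroup to its real cone.\<close>

lemma nonneg_cone_linear_nonneg:
  fixes f :: "'a::real_vector \<Rightarrow> real"
  assumes "linear f" and "\<And>x. x \<in> X \<Longrightarrow> 0 \<le> f x" and "u \<in> nonneg_cone X"
  shows "0 \<le> f u"
proof -
  obtain T c where T: "T \<subseteq> X" "\<forall>x\<in>T. 0 \<le> c x" and u: "u = (\<Sum>x\<in>T. c x *\<^sub>R x)"
    using assms(3) by (auto simp: nonneg_cone_def)
  have "f u = (\<Sum>x\<in>T. c x * f x)"
    using assms(1) by (simp add: u linear_sum linear_scale)
  also have "\<dots> \<ge> 0"
    using T assms(2) by (intro sum_nonneg mult_nonneg_nonneg) auto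
  finally show ?thesis .
qed

text \<open>Homogeneous linear inequalities define a submonoid, so only the four generators have to
  be tested.\<close>

lemma nat_span_A1w_ineqs:
  assumes "v \<in> nat_span A1w"
  shows "0 \<le> v $ 2" and "v $ 2 \<le> 2 * v $ 1" and "v $ 1 \<le> v $ 3"
proof -
  have "nat_span A1w \<subseteq> {v. 0 \<le> v $ 2 \<and> v $ 2 \<le> 2 * v $ 1 \<and> v $ 1 \<le> v $ 3}"
    by (rule nat_span_minimal) (auto simp: A1w_def submonoid_def vector_3)
  with assms show "0 \<le> v $ 2" "v $ 2 \<le> 2 * v $ 1" "v $ 1 \<le> v $ 3"
    by auto
qed

lemma saturation_A1w_ineqs:
  assumes "v \<in> saturation (nat_span A1w)"
  shows "0 \<le> v $ 2" and "v $ 2 \<le> 2 * v $ 1" and "v $ 1 \<le> v $ 3"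
proof -
  have v: "real_vec v \<in> nonneg_cone (real_vec ` nat_span A1w)"
    using assms by (simp add: saturation_def)
  \<comment> \<open>Each inequality is read as nonnegativity of a linear functional on real vectors,
    known on the semigroup, and then cast back to the integers.\<close>
  have "0 \<le> real_vec v $ 2"
    by (rule nonneg_cone_linear_nonneg[OF _ _ v])
      (auto intro!: linearI simp: real_vec_def nat_span_A1w_ineqs)
  then show "0 \<le> v $ 2"
    by (simp add: real_vec_def)
  have "0 \<le> 2 * real_vec v $ 1 - real_vec v $ 2"
    by (rule nonneg_cone_linear_nonneg[OF _ _ v])
      (use nat_span_A1w_ineqs(2) in \<open>force intro!: linearI simp: real_vec_def algebra_simps\<close>)+
  then show "v $ 2 \<le> 2 * v $ 1"
    by (simp add: real_vec_def)
  have "0 \<le> real_vec v $ 3 - real_vec v $ 1"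
    by (rule nonneg_cone_linear_nonneg[OF _ _ v])
      (auto intro!: linearI simp: real_vec_def algebra_simps nat_span_A1w_ineqs)
  then show "v $ 1 \<le> v $ 3"
    by (simp add: real_vec_def)
qed

lemma nat_span_A1w_I:
  assumes "0 \<le> v $ 2" and "v $ 2 \<le> 2 * v $ 1" and "v $ 1 \<le> v $ 3"
  shows "v \<in> nat_span A1w"
proof -
  have gens: "vector [1, 0, 1] \<in> nat_span A1w" "vector [1, 1, 1] \<in> nat_span A1w"
    "vector [1, 2, 1] \<in> nat_span A1w" "vector [0, 0, 1] \<in> nat_span A1w"
    using subset_nat_span[of A1w] by (auto simp: A1w_def)
  show ?thesis
  proof (cases "v $ 2 \<le> v $ 1")
    case True
    \<comment> \<open>All generators but \<open>vector [0, 0, 1]\<close> have equal first and third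
      coordinates, so its coefficient must be \<open>v $ 3 - v $ 1\<close>. The first two
      coordinates fix the others.\<close>
    have "v = (v $ 1 - v $ 2) *s vector [1, 0, 1] + v $ 2 *s vector [1, 1, 1]
        + (v $ 3 - v $ 1) *s vector [0, 0, 1]"
      by (simp add: vec_eq_iff forall_3 vector_3)
    also have "\<dots> \<in> nat_span A1w"
      using assms True by (intro nat_span_add nat_span_scale gens) simp_all
    finally show ?thesis .
  next
    case False
    \<comment> \<open>Here the coefficients solve a + b = \<open>v $ 1\<close> and a + 2b =
      \<open>v $ 2\<close>; the determinant 1 makes them integers.\<close>
    have "v = (2 * v $ 1 - v $ 2) *s vector [1, 1, 1] + (v $ 2 - v $ 1) *s vector [1, 2, 1]
        + (v $ 3 - v $ 1) *s vector [0, 0, 1]"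
      by (simp add: vec_eq_iff forall_3 vector_3)
    also have "\<dots> \<in> nat_span A1w"
      using assms False by (intro nat_span_add nat_span_scale gens) simp_all
    finally show ?thesis .
  qed
qed

theorem proposition3p1:
  shows "saturated (nat_span A1w)"
  unfolding saturated_def
  using subset_saturation[of "nat_span A1w"] saturation_A1w_ineqs nat_span_A1w_I by blast

end
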